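(* Let $X$ be a bipartite graph (with a fixed bipartition into two colour classes) and suppose (adjacency) perfect state transfer occurs between vertices $u$ and $v$ at time $t$, where $u$ and $v$ lie in different colour classes. Then the eigenvalues in the eigenvalue support $\Phi_u$ (which are integers) all have the same power of two in their factorizations, i.e. there is an integer $\alpha\geq 0$ such that every $\theta\in\Phi_u$ is of the form $2^\alpha m$ with $m$ an odd integer. In particular, $0\notin\Phi_u$.
   Context: Graphs are finite, simple and undirected. Let $A$ be the adjacency matrix of $X$ with spectral decomposition $A=\sum_{r=0}^d\theta_r E_r$, where $\theta_0>\dots>\theta_d$ are the distinct eigenvalues and $E_r$ is the orthogonal projection onto the $\theta_r$-eigenspace. For a vertex $u$, $\mathbf{e}_u$ is its characteristic vector, and the eigenvalue support of $u$ is $\Phi_u=\{\theta_r : E_r\mathbf{e}_u\neq 0\}$. There is (adjacency) perfect state transfer between distinct vertices $u$ and $v$ at time $t\geq 0$ if there exists $\gamma\in\mathbb{C}$ with $\exp(\mathrm{i}tA)\mathbf{e}_u=\gamma\mathbf{e}_v$. *)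

theory Defs
  imports "HOL-Analysis.Analysis"
begin

text \<open>
  A graph is given by its adjacency relation on a finite type of vertices.
\<close>

definition simple_graph :: "('v::finite \<Rightarrow> 'v \<Rightarrow> bool) \<Rightarrow> bool" where
  "simple_graph adj \<longleftrightarrow> symp adj \<and> irreflp adj"

definition bipartition :: "('v::finite \<Rightarrow> 'v \<Rightarrow> bool) \<Rightarrow> 'v set \<Rightarrow> 'v set \<Rightarrow> bool" where
  "bipartition adj B C \<longleftrightarrow> B \<union> C = UNIV \<and> B \<inter> C = {} \<and>
     (\<forall>x y. adj x y \<longrightarrow> (x \<in> B \<and> y \<in> C) \<or> (x \<in> C \<and> y \<in> B))"

definition adj_matrix :: "('v::finite \<Rightarrow> 'v \<Rightarrow> bool) \<Rightarrow> real^'v^'v" where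
  "adj_matrix adj = (\<chi> i j. if adj i j then 1 else 0)"

definition eigenspace :: "real^'v^'v \<Rightarrow> real \<Rightarrow> (real^'v) set" where
  "eigenspace A \<theta> = {x. A *v x = \<theta> *\<^sub>R x}"

definition eigenvalues :: "real^'v^'v \<Rightarrow> real set" where
  "eigenvalues A = {\<theta>. \<exists>x \<in> eigenspace A \<theta>. x \<noteq> 0}"

definition orth_proj :: "'a::euclidean_space set \<Rightarrow> 'a \<Rightarrow> 'a" where
  "orth_proj S x = (THE y. y \<in> S \<and> (\<forall>z \<in> S. orthogonal (x - y) z))"

definition eigenvalue_support :: "('v::finite \<Rightarrow> 'v \<Rightarrow> bool) \<Rightarrow> 'v \<Rightarrow> real set" where
  "eigenvalue_support adj u =
     {\<theta> \<in> eigenvalues (adj_matrix adj).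
        orth_proj (eigenspace (adj_matrix adj) \<theta>) (axis u 1) \<noteq> 0}"

text \<open>
  Square matrices carry no Banach algebra instance, so the overloaded \<open>exp\<close> is not
  available for them; this is the exponential series for the matrix product.
\<close>

definition matrix_exp :: "complex^'v^'v \<Rightarrow> complex^'v^'v" where
  "matrix_exp M = (\<Sum>k. (1 / fact k) *\<^sub>R (((**) M ^^ k) (mat 1)))"

definition transition_matrix :: "('v::finite \<Rightarrow> 'v \<Rightarrow> bool) \<Rightarrow> real \<Rightarrow> complex^'v^'v" where
  "transition_matrix adj t =
     matrix_exp (\<chi> i j. \<i> * of_real t * of_real (adj_matrix adj $ i $ j))"

definition perfect_state_transfer ::
    "('v::finite \<Rightarrow> 'v \<Rightarrow> bool) \<Rightarrow> 'v \<Rightarrow> 'v \<Rightarrow> real \<Rightarrow> bool" where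
  "perfect_state_transfer adj u v t \<longleftrightarrow> u \<noteq> v \<and> t \<ge> 0 \<and>
     (\<exists>\<gamma>::complex. transition_matrix adj t *v axis u 1 = \<gamma> *s axis v 1)"

lemma orth_proj_unique:
  assumes "subspace S" "y \<in> S" "\<And>z. z \<in> S \<Longrightarrow> orthogonal (x - y) z"
  shows "orth_proj S x = y"
  unfolding orth_proj_def
proof (rule the_equality)
  show "y \<in> S \<and> (\<forall>z\<in>S. orthogonal (x - y) z)" using assms by blast
next
  fix w assume w: "w \<in> S \<and> (\<forall>z\<in>S. orthogonal (x - w) z)"
  then have "w - y \<in> S" using assms subspace_diff by blast
  then have "(x - y) \<bullet> (w - y) = 0" "(x - w) \<bullet> (w - y) = 0"
    using w assms(3) by (auto simp: orthogonal_def)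
  then have "(w - y) \<bullet> (w - y) = 0" by (simp add: inner_diff_left)
  then show "w = y" by simp
qed

lemma orth_proj_exists:
  assumes "subspace S"
  shows "orth_proj S x \<in> S \<and> (\<forall>z \<in> S. orthogonal (x - orth_proj S x) z)"
proof -
  have S: "span S = S" using assms by (simp add: span_eq_iff)
  obtain y z where yz: "y \<in> S" "\<And>w. w \<in> S \<Longrightarrow> orthogonal z w" "x = y + z"
    using orthogonal_subspace_decomp_exists[of S x] unfolding S by blast
  then have "orth_proj S x = y"
    by (intro orth_proj_unique[OF assms]) auto
  then show ?thesis using yz by simp
qed

end

theory Submission
  imports Defs
begin

text \<open>
  Let \<open>y\<close> be a \<open>\<theta>\<close>-eigenvector. Perfect state transfer gives \<open>exp (\<i> t \<theta>) y\<^sub>u = \<gamma> y\<^sub>v\<close>.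
  Changing the signs of \<open>y\<close> on one colour class gives a \<open>(-\<theta>)\<close>-eigenvector, so also
  \<open>exp (- \<i> t \<theta>) y\<^sub>u = - \<gamma> y\<^sub>v\<close>. If \<open>y\<^sub>u \<noteq> 0\<close>, this forces \<open>exp (2 \<i> t \<theta>) = -1\<close>: every \<open>t \<theta>\<close> with
  \<open>\<theta> \<in> \<Phi>\<^sub>u\<close> is an odd multiple of \<open>\<pi> / 2\<close>, hence \<open>0 \<notin> \<Phi>\<^sub>u\<close> and quotients of elements of \<open>\<Phi>\<^sub>u\<close>
  are quotients of odd integers. It remains to see that \<open>\<Phi>\<^sub>u\<close> consists of integers.

  A \<open>\<rat>\<close>-linear map \<open>\<real> \<rightarrow> \<rat>\<close> fixing \<open>1\<close>, applied to coefficients, turns a real polynomial relation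
  \<open>p(A) e\<^sub>u = w\<close> between integer vectors into a rational one. For the product \<open>p\<close> of all \<open>x - \<theta>\<close>,
  \<open>\<theta> \<in> \<Phi>\<^sub>u\<close>, this shows that \<open>p\<close> is rational, so the sum of the \<open>\<theta>\<^sup>2\<close> is rational, and therefore
  each \<open>\<theta>\<^sup>2\<close> is. For \<open>p\<close> interpolating the ratios \<open>\<kappa>(\<theta>) = y\<^sub>v / y\<^sub>u = \<plusminus>1\<close>, so that \<open>p(A) e\<^sub>u = e\<^sub>v\<close>,
  it gives a rational \<open>q\<close> with \<open>q(\<theta>) = \<kappa>(\<theta>) = - q(-\<theta>)\<close>; thus \<open>\<kappa>(\<theta>)\<close> is \<open>\<theta>\<close> times a rational
  number and \<open>\<theta>\<close> is rational, hence an integer, being an eigenvalue of an integer matrix.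
\<close>

section \<open>Spectral theory of symmetric operators\<close>

text \<open>By compactness the Rayleigh quotient attains a maximum \<open>\<theta>\<close> on the
  unit sphere of \<open>S\<close>. At a maximiser \<open>x\<close> the residual
  \<open>d = T x - \<theta> x\<close> must vanish, since moving from \<open>x\<close> towards
  \<open>d\<close> would increase the quotient.\<close>

lemma symmetric_invariant_subspace_eigenvector:
  fixes T :: "'a::euclidean_space \<Rightarrow> 'a"
  assumes lin: "linear T" and sym: "\<And>x y. T x \<bullet> y = x \<bullet> T y"
    and S: "subspace S" "\<And>x. x \<in> S \<Longrightarrow> T x \<in> S" and ne: "z \<in> S" "z \<noteq> 0"
  obtains x \<theta> where "x \<in> S" "x \<noteq> 0" "T x = \<theta> *\<^sub>R x"
proof -
  let ?K = "S \<inter> sphere 0 1"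
  have "compact ?K"
    using closed_subspace[OF S(1)] by (simp add: closed_Int_compact)
  moreover have "(1 / norm z) *\<^sub>R z \<in> ?K"
    using ne S(1) by (auto intro: subspace_scale)
  moreover have "continuous_on ?K (\<lambda>x. x \<bullet> T x)"
    by (intro continuous_intros linear_continuous_on linear_conv_bounded_linear[THEN iffD1] lin)
  ultimately obtain x where x: "x \<in> ?K" and max: "\<And>y. y \<in> ?K \<Longrightarrow> y \<bullet> T y \<le> x \<bullet> T x"
    using continuous_attains_sup[of ?K "\<lambda>x. x \<bullet> T x"] by (metis empty_iff)
  define \<theta> where "\<theta> = x \<bullet> T x"
  have xx: "x \<bullet> x = 1" using x by (simp add: dot_square_norm)
  have le: "y \<bullet> T y \<le> \<theta> * (y \<bullet> y)" if "y \<in> S" for y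
  proof (cases "y = 0")
    case False
    have "(1 / norm y) *\<^sub>R y \<in> ?K"
      using False that S(1) by (auto intro: subspace_scale)
    from max[OF this] have "(y \<bullet> T y) / (norm y)\<^sup>2 \<le> \<theta>"
      by (simp add: \<theta>_def linear_scale[OF lin] power2_eq_square)
    then show ?thesis using False by (simp add: field_simps dot_square_norm)
  qed (simp add: linear_0[OF lin])
  define d where "d = T x - \<theta> *\<^sub>R x"
  have dS: "d \<in> S" unfolding d_def using x S by (auto intro: subspace_diff subspace_scale)
  define c where "c = \<theta> * (d \<bullet> d) - d \<bullet> T d"
  have c0: "c \<ge> 0" using le[OF dS] by (simp add: c_def)
  have dTx: "d \<bullet> T x - \<theta> * (d \<bullet> x) = d \<bullet> d"
    by (simp add: d_def inner_diff_right inner_diff_left)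
  \<comment> \<open>The maximality inequality at \<open>x + e d\<close>: its left side is linear in
    \<open>e\<close>, its right side quadratic.\<close>
  have var: "2 * e * (d \<bullet> d) \<le> e\<^sup>2 * c" for e :: real
  proof -
    have "x + e *\<^sub>R d \<in> S" using x dS S(1) by (auto intro: subspace_add subspace_scale)
    from le[OF this] have "\<theta> + 2 * e * (d \<bullet> T x) + e\<^sup>2 * (d \<bullet> T d)
        \<le> \<theta> * (1 + 2 * e * (d \<bullet> x) + e\<^sup>2 * (d \<bullet> d))"
      using sym[of x d] xx
      by (simp add: linear_add[OF lin] linear_scale[OF lin] inner_add_left inner_add_right
          inner_commute \<theta>_def power2_eq_square algebra_simps)
    then have "2 * e * (d \<bullet> T x - \<theta> * (d \<bullet> x)) \<le> e\<^sup>2 * c"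
      by (simp add: c_def algebra_simps)
    then show ?thesis by (simp add: dTx)
  qed
  have "d \<bullet> d = 0"
  proof (rule ccontr)
    assume "d \<bullet> d \<noteq> 0"
    then have "d \<bullet> d > 0" by simp
    \<comment> \<open>Then \<open>e c = d \<bullet> d - e\<close>, so \<open>var\<close> divided by
      \<open>e\<close> yields \<open>2 (d \<bullet> d) < d \<bullet> d\<close>. The summand 1 covers
      \<open>c = 0\<close>.\<close>
    define e where "e = (d \<bullet> d) / (c + 1)"
    have "e > 0" "e * (c + 1) = d \<bullet> d" using \<open>d \<bullet> d > 0\<close> c0 by (simp_all add: e_def)
    moreover have "e * (2 * (d \<bullet> d)) \<le> e * (e * c)"
      using var[of e] by (simp add: power2_eq_square algebra_simps)
    ultimately show False using \<open>d \<bullet> d > 0\<close> by (simp add: algebra_simps)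
  qed
  then have "T x = \<theta> *\<^sub>R x" by (simp add: d_def)
  moreover have "x \<noteq> 0" using xx by auto
  ultimately show thesis using that x by blast
qed

text \<open>The vectors orthogonal to all eigenvectors form an invariant subspace; if it were
  nonzero, it would contain an eigenvector orthogonal to itself.\<close>

lemma symmetric_orthogonal_eigenvectors_imp_0:
  fixes T :: "'a::euclidean_space \<Rightarrow> 'a"
  assumes lin: "linear T" and sym: "\<And>x y. T x \<bullet> y = x \<bullet> T y"
    and z: "\<And>y \<theta>. T y = \<theta> *\<^sub>R y \<Longrightarrow> z \<bullet> y = 0"
  shows "z = 0"
proof (rule ccontr)
  assume "z \<noteq> 0"
  define S where "S = {w. \<forall>y \<theta>. T y = \<theta> *\<^sub>R y \<longrightarrow> w \<bullet> y = 0}"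
  have "subspace S" unfolding S_def subspace_def by (auto simp: inner_add_left)
  moreover have "T w \<in> S" if "w \<in> S" for w
    using that by (auto simp: S_def sym)
  moreover have "z \<in> S" using z by (auto simp: S_def)
  ultimately obtain x \<theta> where "x \<in> S" "x \<noteq> 0" "T x = \<theta> *\<^sub>R x"
    using symmetric_invariant_subspace_eigenvector[OF lin sym] \<open>z \<noteq> 0\<close> by metis
  then show False by (auto simp: S_def)
qed

section \<open>Rational functionals and integrality of rational eigenvalues\<close>

text \<open>Extend \<open>{a}\<close> to a basis of the reals over \<rat> and prescribe the value 1
  at \<open>a\<close>.\<close>

lemma rational_projection:
  fixes a :: real
  assumes "a \<noteq> 0"
  obtains \<pi> :: "real \<Rightarrow> rat" where "\<pi> a = 1" "\<And>x y. \<pi> (x + y) = \<pi> x + \<pi> y"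
    "\<And>r x. \<pi> (of_rat r * x) = r * \<pi> x"
proof -
  interpret vector_space_pair "\<lambda>(r::rat) (x::real). of_rat r * x" "\<lambda>(r::rat) (x::rat). r * x"
    by unfold_locales (simp_all add: algebra_simps of_rat_add of_rat_mult)
  have "vs1.independent {a}" using assms by simp
  then obtain g where g: "Vector_Spaces.linear (\<lambda>(r::rat) (x::real). of_rat r * x) (*) g" "g a = 1"
    using linear_independent_extend[of "{a}" "\<lambda>_. 1"] by auto
  interpret g: Vector_Spaces.linear "\<lambda>(r::rat) (x::real). of_rat r * x" "(*)" g by fact
  show thesis using that[of g] g(2) g.add g.scale by auto
qed

text \<open>A \<rat>-linear functional applied entrywise makes the eigenvector rational; its value 1
  at entry \<open>i0\<close> keeps the vector nonzero. After clearing denominators, divisibility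
  shows that the denominator \<open>b\<close> of \<open>r\<close> is 1.\<close>

lemma rational_eigenvalue_integer_matrix:
  fixes A :: "real^'n^'n" and r :: rat
  assumes int: "\<And>i j. A $ i $ j \<in> \<int>" and eig: "A *v y = of_rat r *\<^sub>R y" and "y \<noteq> 0"
  shows "r \<in> \<int>"
proof -
  obtain i0 where "y $ i0 \<noteq> 0" using \<open>y \<noteq> 0\<close> by (auto simp: vec_eq_iff)
  then obtain \<pi> where \<pi>: "\<pi> (y $ i0) = 1" "\<And>x y. \<pi> (x + y) = \<pi> x + \<pi> y"
    "\<And>s x. \<pi> (of_rat s * x) = s * \<pi> x" by (rule rational_projection) blast
  have \<pi>_0: "\<pi> 0 = 0" using \<pi>(3)[of 0 0] by simp
  have \<pi>_sum: "\<pi> (\<Sum>j\<in>J. f j) = (\<Sum>j\<in>J. \<pi> (f j))" for f :: "'n \<Rightarrow> real" and J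
    by (induction J rule: infinite_finite_induct) (auto simp: \<pi> \<pi>_0)
  have B: "A $ i $ j = of_int \<lfloor>A $ i $ j\<rfloor>" for i j
    using int[of i j] by (auto elim: Ints_cases)
  define B where "B i j = \<lfloor>A $ i $ j\<rfloor>" for i j
  note B = B[folded B_def]
  have step: "(\<Sum>j\<in>UNIV. of_int (B i j) * \<pi> (y $ j)) = r * \<pi> (y $ i)" for i
  proof -
    have "(\<Sum>j\<in>UNIV. of_rat (of_int (B i j)) * y $ j) = of_rat r * y $ i"
      using eig by (simp add: vec_eq_iff matrix_vector_mult_def B)
    from arg_cong[OF this, of \<pi>] show ?thesis by (simp only: \<pi>_sum \<pi>)
  qed
  define f where "f i = quotient_of (\<pi> (y $ i))" for i
  define D where "D = (\<Prod>i\<in>UNIV. snd (f i))"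
  have D: "D > 0" unfolding D_def f_def by (intro prod_pos) (simp add: quotient_of_denom_pos')
  have "\<exists>k::int. of_int D * \<pi> (y $ i) = of_int k" for i
  proof -
    have "snd (f i) dvd D" unfolding D_def by (rule dvd_prodI) auto
    then obtain k where k: "D = snd (f i) * k" by (auto elim: dvdE)
    have "\<pi> (y $ i) = of_int (fst (f i)) / of_int (snd (f i))"
      unfolding f_def by (simp add: quotient_of_div)
    moreover have "snd (f i) > 0" by (simp add: f_def quotient_of_denom_pos')
    ultimately have "of_int D * \<pi> (y $ i) = of_int (fst (f i) * k)"
      by (simp add: k)
    then show ?thesis by blast
  qed
  then obtain w where w: "\<And>i. of_int D * \<pi> (y $ i) = of_int (w i)" by metis
  define a b where "a = fst (quotient_of r)" and "b = snd (quotient_of r)"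
  have b: "b > 0" and r: "r = of_int a / of_int b" and ab: "coprime a b"
    unfolding a_def b_def by (simp_all add: quotient_of_denom_pos' quotient_of_div quotient_of_coprime)
  have wstep: "b * (\<Sum>j\<in>UNIV. B i j * w j) = a * w i" for i
  proof -
    have "of_int (\<Sum>j\<in>UNIV. B i j * w j) = of_int D * (\<Sum>j\<in>UNIV. of_int (B i j) * \<pi> (y $ j))"
      by (simp add: sum_distrib_left flip: w) (simp add: algebra_simps)
    also have "\<dots> = r * of_int (w i)" by (simp add: step flip: w)
    finally have "of_int b * of_int (\<Sum>j\<in>UNIV. B i j * w j) = (of_int a * of_int (w i) :: rat)"
      using b by (simp add: r)
    then show ?thesis by (metis of_int_eq_iff of_int_mult)
  qed
  \<comment> \<open>\<open>b B w = a w\<close> with \<open>a, b\<close> coprime makes the integer vector \<open>w\<close> divisible by all powers of \<open>b\<close>.\<close>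
  have dvd: "b ^ k dvd w i" for k i
  proof (induction k arbitrary: i)
    case (Suc k)
    have "b ^ k dvd (\<Sum>j\<in>UNIV. B i j * w j)" using Suc by (intro dvd_sum dvd_mult) auto
    then have "b * b ^ k dvd b * (\<Sum>j\<in>UNIV. B i j * w j)" by (rule mult_dvd_mono[OF dvd_refl])
    then have "b ^ Suc k dvd a * w i" unfolding wstep by simp
    moreover have "coprime (b ^ Suc k) a" using ab by (metis coprime_commute coprime_power_left_iff)
    ultimately show ?case by (simp only: coprime_dvd_mult_right_iff)
  qed simp
  have "w i0 = D" using w[of i0] \<pi>(1) by simp
  have "b = 1"
  proof (rule ccontr)
    assume "b \<noteq> 1"
    then have "2 \<le> b" using b by simp
    \<comment> \<open>The exponent \<open>D\<close> is large enough: \<open>b ^ D\<close> divides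
      \<open>w i0 = D\<close>, yet exceeds it.\<close>
    have "int (nat D) < 2 ^ nat D" by (rule of_nat_less_two_power)
    also have "\<dots> \<le> b ^ nat D" using \<open>2 \<le> b\<close> by (intro power_mono) auto
    also have "\<dots> \<le> D" using dvd[of "nat D" i0] D \<open>w i0 = D\<close> by (simp add: zdvd_imp_le)
    finally show False using D by simp
  qed
  then show ?thesis by (simp add: r)
qed


section \<open>Polynomials in a symmetric operator\<close>

text \<open>The vector \<open>p(T) x\<close>, expressed through iterates of \<open>T\<close> on
  vectors instead of powers of a matrix.\<close>

definition poly_apply :: "('a::real_vector \<Rightarrow> 'a) \<Rightarrow> real poly \<Rightarrow> 'a \<Rightarrow> 'a" where
  "poly_apply T p x = (\<Sum>k\<le>degree p. coeff p k *\<^sub>R (T ^^ k) x)"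

lemma symmetric_funpow:
  fixes T :: "'a::real_inner \<Rightarrow> 'a"
  assumes "\<And>x y. T x \<bullet> y = x \<bullet> T y"
  shows "(T ^^ k) x \<bullet> y = x \<bullet> (T ^^ k) y"
  by (induction k arbitrary: x y) (simp_all add: assms funpow_swap1)

lemma poly_apply_symmetric:
  fixes T :: "'a::real_inner \<Rightarrow> 'a"
  assumes "\<And>x y. T x \<bullet> y = x \<bullet> T y"
  shows "poly_apply T p x \<bullet> y = x \<bullet> poly_apply T p y"
  by (simp add: poly_apply_def inner_sum_left inner_sum_right symmetric_funpow[OF assms])

lemma poly_apply_inner_eigenvector:
  fixes T :: "'a::real_inner \<Rightarrow> 'a"
  assumes sym: "\<And>x y. T x \<bullet> y = x \<bullet> T y" and eig: "T y = \<theta> *\<^sub>R y"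
  shows "poly_apply T p x \<bullet> y = poly p \<theta> * (x \<bullet> y)"
proof -
  have "(T ^^ k) x \<bullet> y = \<theta> ^ k * (x \<bullet> y)" for k
    by (induction k) (simp_all add: sym eig)
  then show ?thesis
    by (simp add: poly_apply_def poly_altdef inner_sum_left sum_distrib_right mult.assoc)
qed

text \<open>Eigenvectors separate vectors, so an identity \<open>p(T) x = w\<close> reduces to
  scalar identities at the eigenvalues.\<close>

lemma poly_apply_eqI:
  fixes T :: "'a::euclidean_space \<Rightarrow> 'a"
  assumes lin: "linear T" and sym: "\<And>x y. T x \<bullet> y = x \<bullet> T y"
    and "\<And>y \<theta>. T y = \<theta> *\<^sub>R y \<Longrightarrow> poly p \<theta> * (x \<bullet> y) = w \<bullet> y"
  shows "poly_apply T p x = w"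
proof -
  have "poly_apply T p x - w = 0"
    by (rule symmetric_orthogonal_eigenvectors_imp_0[OF lin sym])
      (metis inner_diff_left poly_apply_inner_eigenvector[OF sym] assms(3) diff_self)
  then show ?thesis by simp
qed

text \<open>The vectors \<open>A^k x\<close> are integral, so \<open>p(A) x = w\<close> is a system
  of integer linear equations in the coefficients of \<open>p\<close>. A \<rat>-linear functional
  fixing 1 maps real solutions to rational ones and keeps a monic polynomial monic.\<close>

lemma poly_apply_rational_coeffs:
  fixes A :: "real^'n^'n"
  assumes A: "\<And>i j. A $ i $ j \<in> \<int>" and x: "\<And>i. x $ i \<in> \<int>" and w: "\<And>i. w $ i \<in> \<int>"
    and p: "poly_apply ((*v) A) p x = w"
  obtains q where "\<And>k. coeff q k \<in> \<rat>" "degree q \<le> degree p"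
    "\<And>k. coeff p k = 1 \<Longrightarrow> coeff q k = 1" "poly_apply ((*v) A) q x = w"
proof -
  obtain \<pi> :: "real \<Rightarrow> rat" where \<pi>: "\<pi> 1 = 1" "\<And>x y. \<pi> (x + y) = \<pi> x + \<pi> y"
    "\<And>r x. \<pi> (of_rat r * x) = r * \<pi> x"
    using rational_projection[OF one_neq_zero] by blast
  have \<pi>_0: "\<pi> 0 = 0" using \<pi>(3)[of 0 0] by simp
  have \<pi>_sum: "\<pi> (\<Sum>j\<in>J. f j) = (\<Sum>j\<in>J. \<pi> (f j))" for f :: "nat \<Rightarrow> real" and J
    by (induction J rule: infinite_finite_induct) (auto simp: \<pi> \<pi>_0)
  have \<pi>_int: "\<pi> (c * z) = \<pi> c * of_int \<lfloor>z\<rfloor>" if "z \<in> \<int>" for c z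
    using that \<pi>(3)[of "of_int \<lfloor>z\<rfloor>" c] by (auto elim!: Ints_cases simp: mult.commute)
  define q :: "real poly" where "q = map_poly (\<lambda>c. of_rat (\<pi> c)) p"
  have cq: "coeff q k = of_rat (\<pi> (coeff p k))" for k
    by (simp add: q_def coeff_map_poly \<pi>_0)
  have dq: "degree q \<le> degree p" unfolding q_def by (rule degree_le) (simp add: coeff_map_poly \<pi>_0 coeff_eq_0)
  have pow: "(((*v) A) ^^ k) x $ i \<in> \<int>" for k i
  proof (induction k arbitrary: i)
    case (Suc k)
    then show ?case by (auto simp: matrix_vector_mult_def intro!: Ints_sum Ints_mult A)
  qed (simp add: x)
  have "poly_apply ((*v) A) q x $ i = w $ i" for i
  proof -
    let ?z = "\<lambda>k. (((*v) A) ^^ k) x $ i"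
    have wi: "w $ i = (\<Sum>k\<le>degree p. coeff p k * ?z k)"
      by (simp flip: p add: poly_apply_def)
    have "poly_apply ((*v) A) q x $ i = (\<Sum>k\<le>degree q. coeff q k * ?z k)"
      by (simp add: poly_apply_def)
    \<comment> \<open>The functional may kill leading coefficients, so the sum is padded with
      zeros.\<close>
    also have "\<dots> = (\<Sum>k\<le>degree p. coeff q k * ?z k)"
      using dq by (intro sum.mono_neutral_left) (auto simp: coeff_eq_0)
    also have "\<dots> = (\<Sum>k\<le>degree p. of_rat (\<pi> (coeff p k * ?z k)))"
    proof (rule sum.cong[OF refl])
      fix k
      show "coeff q k * ?z k = of_rat (\<pi> (coeff p k * ?z k))"
        using pow[of k i] unfolding \<pi>_int[OF pow] cq
        by (auto elim!: Ints_cases simp: of_rat_mult)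
    qed
    also have "\<dots> = of_rat (\<pi> (w $ i))" by (simp add: wi \<pi>_sum of_rat_sum)
    also have "\<dots> = w $ i"
      using \<pi>_int[OF w[of i], of 1] w[of i] \<pi>(1) by (auto elim!: Ints_cases)
    finally show ?thesis .
  qed
  then show thesis using that[of q] cq dq \<pi>(1) by (auto simp: vec_eq_iff)
qed

section \<open>Power sums and interpolation\<close>

text \<open>Newton's identity: the sum of squares is \<open>e1^2 - 2 e2\<close> in elementary
  symmetric functions. In the reversed polynomial \<open>P\<close> these sit, up to sign, at the
  fixed positions 1 and 2, which suits induction on \<open>S\<close>.\<close>

lemma sum_squares_roots_rational:
  fixes S :: "real set"
  assumes "finite S" and p: "\<And>k. coeff (\<Prod>s\<in>S. [:- s, 1:]) k \<in> \<rat>" and "0 \<notin> S"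
  shows "(\<Sum>s\<in>S. s\<^sup>2) \<in> \<rat>"
proof -
  define P where "P = (\<Prod>s\<in>S. [:1, - s:])"
  have "P = reflect_poly (\<Prod>s\<in>S. [:- s, 1:])"
    unfolding P_def reflect_poly_prod
  proof (rule prod.cong[OF refl])
    fix s assume "s \<in> S"
    then have "- s \<noteq> 0" using assms(3) by auto
    then show "[:1, - s:] = reflect_poly [:- s, 1:]"
      by (subst reflect_poly_pCons) auto
  qed
  then have rat: "coeff P k \<in> \<rat>" for k
    using p by (simp add: coeff_reflect_poly)
  have "coeff (\<Prod>s\<in>S. [:1, - s:]) 0 = 1 \<and>
    2 * coeff (\<Prod>s\<in>S. [:1, - s:]) 2 = (coeff (\<Prod>s\<in>S. [:1, - s:]) 1)\<^sup>2 - (\<Sum>s\<in>S. s\<^sup>2)"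
    using assms(1)
  proof induction
    case (insert a S)
    then show ?case
      by (simp add: numeral_2_eq_2 coeff_pCons power2_eq_square algebra_simps)
  qed (simp add: coeff_pCons numeral_2_eq_2)
  then have "(\<Sum>s\<in>S. s\<^sup>2) = (coeff P 1)\<^sup>2 - 2 * coeff P 2" by (simp add: P_def)
  then show ?thesis using rat by simp
qed

text \<open>Newton interpolation: a new node is met by adding a multiple of a polynomial vanishing
  at the old ones.\<close>

lemma poly_interpolation:
  fixes f :: "real \<Rightarrow> real"
  assumes "finite S"
  obtains p where "\<And>x. x \<in> S \<Longrightarrow> poly p x = f x"
proof -
  have "\<exists>p. \<forall>x\<in>S. poly p x = f x" using assms
  proof induction
    case (insert a S)
    then obtain p where p: "\<forall>x\<in>S. poly p x = f x" by blast
    define m where "m = (\<Prod>s\<in>S. [:- s, 1:])"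
    have m: "poly m x = (\<Prod>s\<in>S. x - s)" for x by (simp add: m_def poly_prod)
    have "poly m a \<noteq> 0" "\<forall>x\<in>S. poly m x = 0"
      using insert by (auto simp: m)
    then have "\<forall>x\<in>insert a S. poly (p + smult ((f a - poly p a) / poly m a) m) x = f x"
      using p by auto
    then show ?case by blast
  qed simp
  then show thesis using that by blast
qed

section \<open>The matrix exponential on eigenvectors\<close>

text \<open>Pairing \<open>c\<close> with column \<open>u\<close> is a bounded functional
  \<open>\<phi>\<close>, so it passes through the series; left multiplication by \<open>M\<close>
  multiplies its value by \<open>\<mu>\<close>.\<close>

lemma matrix_exp_left_eigenvector:
  fixes M :: "complex^'n^'n"
  assumes eig: "\<And>l. (\<Sum>i\<in>UNIV. c i * M $ i $ l) = \<mu> * c l"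
  shows "(\<Sum>i\<in>UNIV. c i * matrix_exp M $ i $ u) = exp \<mu> * c u"
proof -
  define \<phi> where "\<phi> X = (\<Sum>i\<in>UNIV. c i * X $ i $ u)" for X :: "complex^'n^'n"
  have "linear \<phi>"
    by (rule linearI) (simp_all add: \<phi>_def algebra_simps sum.distrib scaleR_sum_right)
  then have bl: "bounded_linear \<phi>" by (simp add: linear_conv_bounded_linear)
  have "linear ((**) M :: complex^'n^'n \<Rightarrow> _)"
    by (rule linearI)
      (simp_all add: vec_eq_iff matrix_matrix_mult_def scaleR_sum_right distrib_left sum.distrib)
  then have "bounded_linear ((**) M :: complex^'n^'n \<Rightarrow> _)" by (simp add: linear_conv_bounded_linear)
  \<comment> \<open>\<open>K\<close> bounds left multiplication by \<open>M\<close>, so the series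
    is dominated by a multiple of that of \<open>exp K\<close>.\<close>
  then obtain K where K: "K > 0" "\<And>X :: complex^'n^'n. norm (M ** X) \<le> norm X * K"
    using bounded_linear.pos_bounded by blast
  have bound: "norm (((**) M ^^ k) (mat 1)) \<le> K ^ k * norm (mat 1 :: complex^'n^'n)" for k
  proof (induction k)
    case (Suc k)
    have "norm (((**) M ^^ Suc k) (mat 1)) \<le> norm (((**) M ^^ k) (mat 1)) * K"
      using K(2) by simp
    also have "\<dots> \<le> (K ^ k * norm (mat 1 :: complex^'n^'n)) * K"
      using Suc K(1) by (intro mult_right_mono) auto
    finally show ?case by (simp add: mult_ac)
  qed simp
  have summ: "summable (\<lambda>k. (1 / fact k) *\<^sub>R (((**) M ^^ k) (mat 1)))"
  proof (rule summable_comparison_test')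
    show "summable (\<lambda>k. (inverse (fact k) * K ^ k) * norm (mat 1 :: complex^'n^'n))"
      by (intro summable_mult2 summable_exp)
    show "norm ((1 / fact k) *\<^sub>R (((**) M ^^ k) (mat 1)))
        \<le> (inverse (fact k) * K ^ k) * norm (mat 1 :: complex^'n^'n)" if "k \<ge> 0" for k
      using bound[of k] by (simp add: divide_simps)
  qed
  have step: "\<phi> (M ** X) = \<mu> * \<phi> X" for X
  proof -
    have "\<phi> (M ** X) = (\<Sum>i\<in>UNIV. \<Sum>l\<in>UNIV. c i * M $ i $ l * X $ l $ u)"
      by (simp add: \<phi>_def matrix_matrix_mult_def sum_distrib_left mult.assoc)
    also have "\<dots> = (\<Sum>l\<in>UNIV. (\<Sum>i\<in>UNIV. c i * M $ i $ l) * X $ l $ u)"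
      by (subst sum.swap) (simp add: sum_distrib_right)
    also have "\<dots> = \<mu> * \<phi> X" by (simp add: eig \<phi>_def sum_distrib_left mult.assoc)
    finally show ?thesis .
  qed
  have base: "\<phi> (mat 1) = c u"
    by (simp add: \<phi>_def mat_def if_distrib[of "\<lambda>x. _ * x"] cong: if_cong)
  have pow: "\<phi> (((**) M ^^ k) (mat 1)) = \<mu> ^ k * c u" for k
    by (induction k) (simp_all add: step base)
  have "\<phi> (matrix_exp M) = (\<Sum>k. \<phi> ((1 / fact k) *\<^sub>R (((**) M ^^ k) (mat 1))))"
    unfolding matrix_exp_def by (rule bounded_linear.suminf[OF bl summ])
  also have "\<dots> = (\<Sum>k. (\<mu> ^ k /\<^sub>R fact k) * c u)"
    by (simp add: linear_scale[OF \<open>linear \<phi>\<close>] pow divide_inverse)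
  also have "\<dots> = exp \<mu> * c u"
    unfolding exp_def by (rule suminf_mult2[symmetric]) (rule summable_exp_generic)
  finally show ?thesis by (simp add: \<phi>_def)
qed

section \<open>Symmetric matrices and the eigenvalue support\<close>

lemma symmetric_matrix_inner:
  fixes A :: "real^'n^'n"
  assumes "transpose A = A"
  shows "(A *v x) \<bullet> y = x \<bullet> (A *v y)"
  by (metis assms dot_lmul_matrix transpose_matrix_vector)

text \<open>Eigenvectors chosen one per eigenvalue are pairwise orthogonal and nonzero, hence
  distinct and finite in number.\<close>

lemma finite_eigenvalues_symmetric:
  fixes A :: "real^'n^'n"
  assumes "transpose A = A"
  shows "finite (eigenvalues A)"
proof -
  define f where "f \<theta> = (SOME x. x \<in> eigenspace A \<theta> \<and> x \<noteq> 0)" for \<theta>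
  have f: "A *v f \<theta> = \<theta> *\<^sub>R f \<theta>" "f \<theta> \<noteq> 0" if "\<theta> \<in> eigenvalues A" for \<theta>
  proof -
    have "\<exists>x. x \<in> eigenspace A \<theta> \<and> x \<noteq> 0" using that by (auto simp: eigenvalues_def)
    from someI_ex[OF this] show "A *v f \<theta> = \<theta> *\<^sub>R f \<theta>" "f \<theta> \<noteq> 0"
      by (simp_all add: f_def eigenspace_def)
  qed
  have orth: "f \<theta> \<bullet> f \<phi> = 0" if "\<theta> \<in> eigenvalues A" "\<phi> \<in> eigenvalues A" "\<theta> \<noteq> \<phi>" for \<theta> \<phi>
    using symmetric_matrix_inner[OF assms, of "f \<theta>" "f \<phi>"] that by (simp add: f)
  have "pairwise orthogonal (f ` eigenvalues A)"
    using orth by (auto simp: pairwise_def orthogonal_def)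
  then have "finite (f ` eigenvalues A)" by (rule pairwise_orthogonal_imp_finite)
  moreover have "inj_on f (eigenvalues A)"
    using orth f(2) by (metis inj_onI inner_eq_zero_iff)
  ultimately show ?thesis by (rule finite_imageD)
qed

lemma adj_matrix_symmetric: "simple_graph adj \<Longrightarrow> transpose (adj_matrix adj) = adj_matrix adj"
  by (auto simp: simple_graph_def transpose_def adj_matrix_def vec_eq_iff dest: sympD)

text \<open>The projection \<open>?x\<close> of \<open>axis u 1\<close> represents evaluation at
  \<open>u\<close> on the eigenspace, so it vanishes iff all eigenvectors do at \<open>u\<close>. If
  nonzero, it is itself a witness, with entry \<open>?x \<bullet> ?x\<close> at
  \<open>u\<close>.\<close>

lemma mem_eigenvalue_support_iff:
  "\<theta> \<in> eigenvalue_support adj u \<longleftrightarrow>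
     (\<exists>y. adj_matrix adj *v y = \<theta> *\<^sub>R y \<and> y $ u \<noteq> 0)"
proof -
  let ?E = "eigenspace (adj_matrix adj) \<theta>"
  let ?x = "orth_proj ?E (axis u 1)"
  have sub: "subspace ?E"
    by (auto simp: subspace_def eigenspace_def algebra_simps matrix_vector_mult_scaleR)
  have x: "?x \<in> ?E" "\<And>z. z \<in> ?E \<Longrightarrow> (axis u 1 - ?x) \<bullet> z = 0"
    using orth_proj_exists[OF sub, of "axis u 1"] by (auto simp: orthogonal_def)
  have xz: "z $ u = ?x \<bullet> z" if "z \<in> ?E" for z
    using x(2)[OF that] by (simp add: inner_diff_left inner_axis')
  show ?thesis
  proof
    assume "\<theta> \<in> eigenvalue_support adj u"
    then have "?x \<noteq> 0" by (simp add: eigenvalue_support_def)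
    then show "\<exists>y. adj_matrix adj *v y = \<theta> *\<^sub>R y \<and> y $ u \<noteq> 0"
      using xz[OF x(1)] x(1) by (intro exI[of _ ?x]) (auto simp: eigenspace_def)
  next
    assume "\<exists>y. adj_matrix adj *v y = \<theta> *\<^sub>R y \<and> y $ u \<noteq> 0"
    then obtain y where y: "y \<in> ?E" "y $ u \<noteq> 0" by (auto simp: eigenspace_def)
    then have "?x \<noteq> 0" "y \<noteq> 0" using xz[OF y(1)] by auto
    then show "\<theta> \<in> eigenvalue_support adj u"
      using y(1) by (auto simp: eigenvalue_support_def eigenvalues_def)
  qed
qed

section \<open>State transfer and bipartiteness on eigenvectors\<close>

text \<open>Pair both sides of the transfer equation with \<open>y\<close>. One
  \<open>\<gamma>\<close> serves all eigenvectors.\<close>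

lemma perfect_state_transfer_eigenvector:
  assumes "simple_graph adj" "perfect_state_transfer adj u v t"
  obtains \<gamma> where "\<And>\<theta> y. adj_matrix adj *v y = \<theta> *\<^sub>R y \<Longrightarrow>
    exp (\<i> * of_real (t * \<theta>)) * of_real (y $ u) = \<gamma> * of_real (y $ v)"
proof -
  let ?A = "adj_matrix adj"
  let ?U = "transition_matrix adj t"
  obtain \<gamma> where \<gamma>: "?U *v axis u 1 = \<gamma> *s axis v 1"
    using assms(2) by (auto simp: perfect_state_transfer_def)
  have U: "?U $ i $ u = (if i = v then \<gamma> else 0)" for i
    using arg_cong[OF \<gamma>, of "\<lambda>x. x $ i"]
    by (simp add: matrix_vector_mult_def axis_def if_distrib[of "\<lambda>x. _ * x"] cong: if_cong)
  have "exp (\<i> * of_real (t * \<theta>)) * of_real (y $ u) = \<gamma> * of_real (y $ v)"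
    if y: "?A *v y = \<theta> *\<^sub>R y" for \<theta> y
  proof -
    \<comment> \<open>By symmetry \<open>y\<close> is also a left eigenvector.\<close>
    have sym: "?A $ i $ l = ?A $ l $ i" for i l
      using assms(1) by (auto simp: simple_graph_def adj_matrix_def dest: sympD)
    have "(\<Sum>i\<in>UNIV. of_real (y $ i) * ?U $ i $ u) = exp (\<i> * of_real (t * \<theta>)) * of_real (y $ u)"
      unfolding transition_matrix_def
    proof (rule matrix_exp_left_eigenvector)
      fix l
      have "(\<Sum>i\<in>UNIV. ?A $ l $ i * y $ i) = \<theta> * y $ l"
        using arg_cong[OF y, of "\<lambda>x. x $ l"] by (simp add: matrix_vector_mult_def)
      then have *: "(\<Sum>i\<in>UNIV. of_real (?A $ l $ i) * of_real (y $ i)) = complex_of_real (\<theta> * y $ l)"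
        by (simp flip: of_real_mult of_real_sum)
      have "(\<Sum>i\<in>UNIV. of_real (y $ i) *
           (\<chi> i j. \<i> * complex_of_real t * of_real (?A $ i $ j)) $ i $ l) =
         \<i> * of_real t * (\<Sum>i\<in>UNIV. of_real (?A $ l $ i) * of_real (y $ i))"
        by (simp add: sum_distrib_left sym[of _ l] mult_ac)
      then show "(\<Sum>i\<in>UNIV. of_real (y $ i) *
           (\<chi> i j. \<i> * complex_of_real t * of_real (?A $ i $ j)) $ i $ l) =
         \<i> * of_real (t * \<theta>) * of_real (y $ l)"
        unfolding * by (simp add: mult_ac)
    qed
    then show ?thesis
      by (simp add: U if_distrib[of "\<lambda>x. _ * x"] mult.commute cong: if_cong)
  qed
  then show thesis by (rule that)
qed

text \<open>Edges join opposite classes, so the adjacency matrix anticommutes with the diagonal sign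
  matrix of the bipartition.\<close>

lemma bipartite_eigenvector_negate:
  assumes bip: "bipartition adj B C" and y: "adj_matrix adj *v y = \<theta> *\<^sub>R y"
  shows "adj_matrix adj *v (\<chi> i. if i \<in> B then y $ i else - y $ i) =
    (- \<theta>) *\<^sub>R (\<chi> i. if i \<in> B then y $ i else - y $ i)"
proof (subst vec_eq_iff, rule allI)
  fix i
  let ?A = "adj_matrix adj"
  have "(\<Sum>j\<in>UNIV. ?A $ i $ j * (if j \<in> B then y $ j else - y $ j)) =
    (\<Sum>j\<in>UNIV. (if i \<in> B then - 1 else 1) * (?A $ i $ j * y $ j))"
    using bip by (intro sum.cong) (force simp: bipartition_def adj_matrix_def)+
  also have "\<dots> = (if i \<in> B then - 1 else 1) * (\<theta> * y $ i)"
    using arg_cong[OF y, of "\<lambda>x. x $ i"]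
    by (simp add: matrix_vector_mult_def flip: sum_distrib_left)
  finally show "(?A *v (\<chi> i. if i \<in> B then y $ i else - y $ i)) $ i =
      ((- \<theta>) *\<^sub>R (\<chi> i. if i \<in> B then y $ i else - y $ i)) $ i"
    by (simp add: matrix_vector_mult_def split: if_splits)
qed

section \<open>Rationality of the support\<close>

text \<open>This isolates what transfer and bipartiteness provide: \<open>\<kappa>\<close> is the
  ratio of the entries at \<open>v\<close> and \<open>u\<close>, \<open>K\<close> the common value
  of its squares, and \<open>neg\<close> the effect of the sign change.\<close>

lemma cospectral_symmetric_support_rational:
  fixes A :: "real^'n^'n" and \<kappa> :: "real \<Rightarrow> real" and K :: real and u v :: 'n
  defines "\<Phi> \<equiv> {\<theta>. \<exists>y. A *v y = \<theta> *\<^sub>R y \<and> y $ u \<noteq> 0}"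
  assumes sym: "transpose A = A" and int: "\<And>i j. A $ i $ j \<in> \<int>"
    and ratio: "\<And>\<theta> \<phi>. \<theta> \<in> \<Phi> \<Longrightarrow> \<phi> \<in> \<Phi> \<Longrightarrow> \<theta> / \<phi> \<in> \<rat>" and nz: "0 \<notin> \<Phi>"
    and \<kappa>: "\<And>\<theta> y. A *v y = \<theta> *\<^sub>R y \<Longrightarrow> y $ v = \<kappa> \<theta> * y $ u"
    and K: "\<And>\<theta>. \<theta> \<in> \<Phi> \<Longrightarrow> (\<kappa> \<theta>)\<^sup>2 = K"
    and neg: "\<And>\<theta>. \<theta> \<in> \<Phi> \<Longrightarrow> - \<theta> \<in> \<Phi> \<and> \<kappa> (- \<theta>) = - \<kappa> \<theta>"
  shows "\<Phi> \<subseteq> \<rat>"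
proof
  fix \<theta> assume \<theta>: "\<theta> \<in> \<Phi>"
  let ?T = "(*v) A"
  let ?e = "\<lambda>i. axis i (1::real) :: real^'n"
  have lin: "linear ?T" by (rule matrix_vector_mul_linear)
  note symm = symmetric_matrix_inner[OF sym]
  have e: "?e i \<bullet> y = y $ i" for i and y :: "real^'n" by (simp add: inner_axis')
  have e_int: "?e i $ j \<in> \<int>" for i j by (simp add: axis_def)
  have "\<Phi> \<subseteq> eigenvalues A" by (auto simp: \<Phi>_def eigenvalues_def eigenspace_def)
  then have fin: "finite \<Phi>" using finite_eigenvalues_symmetric[OF sym] finite_subset by blast

  define p where "p = (\<Prod>s\<in>\<Phi>. [:- s, 1:])"
  have dp: "degree p = card \<Phi>" unfolding p_def by (subst degree_prod_sum_eq) auto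
  have lp: "coeff p (card \<Phi>) = 1"
    using lead_coeff_prod[of "\<lambda>s. [:- s, 1:]" \<Phi>] dp by (simp add: p_def)
  have p0: "poly p s = 0" if "s \<in> \<Phi>" for s using that fin by (auto simp: p_def poly_prod)
  have "poly_apply ?T p (?e u) = 0"
    using p0 by (intro poly_apply_eqI lin symm) (auto simp: e \<Phi>_def)
  then obtain p' where p': "\<And>k. coeff p' k \<in> \<rat>" "degree p' \<le> degree p"
    "\<And>k. coeff p k = 1 \<Longrightarrow> coeff p' k = 1" "poly_apply ?T p' (?e u) = 0"
    by (rule poly_apply_rational_coeffs[OF int e_int, rotated]) auto
  have "poly p' s = 0" if s: "s \<in> \<Phi>" for s
  proof -
    obtain y where "A *v y = s *\<^sub>R y" "y $ u \<noteq> 0" using s by (auto simp: \<Phi>_def)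
    with poly_apply_inner_eigenvector[of ?T y s p' "?e u", OF symm] p'(4) show ?thesis
      by (simp add: e)
  qed
  \<comment> \<open>Both are monic of degree \<open>card \<Phi>\<close> and vanish on
    \<open>\<Phi>\<close>; hence \<open>p\<close> has rational coefficients.\<close>
  then have "p = p'"
    using p0 p'(2) p'(3)[OF lp] lp dp
    by (intro poly_eqI_degree_lead_coeff[of p "card \<Phi>" p' \<Phi>]) auto
  then have "(\<Sum>s\<in>\<Phi>. s\<^sup>2) \<in> \<rat>"
    using p'(1) fin nz by (intro sum_squares_roots_rational) (auto simp: p_def)
  moreover have "(\<Sum>s\<in>\<Phi>. s\<^sup>2) = \<theta>\<^sup>2 * (\<Sum>s\<in>\<Phi>. (s / \<theta>)\<^sup>2)"
    using nz \<theta> by (auto simp: sum_distrib_left power_divide intro!: sum.cong)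
  moreover have "(\<Sum>s\<in>\<Phi>. (s / \<theta>)\<^sup>2) \<in> \<rat>"
    using ratio \<theta> by (intro Rats_sum Rats_power) auto
  \<comment> \<open>The term \<open>s = \<theta>\<close> is 1, so division by this sum is
    possible.\<close>
  moreover have "(\<Sum>s\<in>\<Phi>. (s / \<theta>)\<^sup>2) \<ge> (\<theta> / \<theta>)\<^sup>2"
    using \<theta> fin by (intro member_le_sum) auto
  then have "(\<Sum>s\<in>\<Phi>. (s / \<theta>)\<^sup>2) \<noteq> 0" using nz \<theta> by (auto split: if_splits)
  ultimately have sq: "\<theta>\<^sup>2 \<in> \<rat>"
    by (metis Rats_divide nonzero_mult_div_cancel_right)

  obtain q where q: "\<And>s. s \<in> \<Phi> \<Longrightarrow> poly q s = \<kappa> s"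
    using poly_interpolation[OF fin] by blast
  have qy: "poly q s * y $ u = y $ v" if "A *v y = s *\<^sub>R y" for s y
    using q[of s] \<kappa>[OF that] that by (cases "y $ u = 0") (auto simp: \<Phi>_def)
  have quv: "poly_apply ?T q (?e u) = ?e v"
    using qy by (intro poly_apply_eqI lin symm) (auto simp: e)
  have "poly_apply ?T q (?e v) = K *\<^sub>R ?e u"
  proof (intro poly_apply_eqI lin symm)
    fix y s assume y: "A *v y = s *\<^sub>R y"
    show "poly q s * (?e v \<bullet> y) = (K *\<^sub>R ?e u) \<bullet> y"
    proof (cases "y $ u = 0")
      case True
      then show ?thesis using \<kappa>[OF y] by (simp add: e)
    next
      case False
      then have "s \<in> \<Phi>" using y by (auto simp: \<Phi>_def)
      then show ?thesis using q K[of s] \<kappa>[OF y] by (simp add: e power2_eq_square)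
    qed
  qed
  \<comment> \<open>\<open>q(A)\<close> is self-adjoint and maps \<open>e\<^sub>u\<close> to \<open>e\<^sub>v\<close> and \<open>e\<^sub>v\<close> to \<open>K e\<^sub>u\<close>.\<close>
  then have "K = poly_apply ?T q (?e v) \<bullet> ?e u" by (simp add: inner_axis_axis)
  also have "\<dots> = ?e v \<bullet> ?e v" by (simp add: poly_apply_symmetric[OF symm] quv)
  finally have "K = 1" by (simp add: inner_axis_axis)

  obtain q' where q': "\<And>k. coeff q' k \<in> \<rat>" "poly_apply ?T q' (?e u) = ?e v"
    by (rule poly_apply_rational_coeffs[OF int e_int e_int quv]) auto
  have q'\<kappa>: "poly q' s = \<kappa> s" if s: "s \<in> \<Phi>" for s
  proof -
    obtain y where y: "A *v y = s *\<^sub>R y" "y $ u \<noteq> 0" using s by (auto simp: \<Phi>_def)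
    have "poly q' s * y $ u = y $ v"
      using poly_apply_inner_eigenvector[of ?T y s q' "?e u", OF symm y(1)] q'(2) by (simp add: e)
    then show ?thesis using \<kappa>[OF y(1)] y(2) by simp
  qed
  \<comment> \<open>Even and odd parts of \<open>r\<close>: as \<open>\<theta>\<^sup>2\<close> is
    rational, each contributes a rational number, the odd one times \<open>\<theta>\<close>.\<close>
  have "\<exists>a\<in>\<rat>. \<exists>b\<in>\<rat>. poly r \<theta> = a + b * \<theta> \<and> poly r (- \<theta>) = a - b * \<theta>"
    if "\<And>k. coeff r k \<in> \<rat>" for r
    using that
  proof (induction r)
    case (pCons c r)
    have "c \<in> \<rat>" "coeff r k \<in> \<rat>" for k
      using pCons.prems[of 0] pCons.prems[of "Suc k"] by simp_all
    with pCons.IH obtain a b where ab: "a \<in> \<rat>" "b \<in> \<rat>"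
      "poly r \<theta> = a + b * \<theta>" "poly r (- \<theta>) = a - b * \<theta>" by blast
    then have "c + b * \<theta>\<^sup>2 \<in> \<rat>" using sq \<open>c \<in> \<rat>\<close> by simp
    moreover have "poly (pCons c r) \<theta> = (c + b * \<theta>\<^sup>2) + a * \<theta>"
      "poly (pCons c r) (- \<theta>) = (c + b * \<theta>\<^sup>2) - a * \<theta>"
      unfolding poly_pCons ab(3,4) by (simp_all add: algebra_simps power2_eq_square)
    ultimately show ?case using ab(1) by blast
  next
    case 0
    show ?case by (intro bexI[of _ 0]) simp_all
  qed
  from this[OF q'(1)] obtain a b where ab: "a \<in> \<rat>" "b \<in> \<rat>"
    "\<kappa> \<theta> = a + b * \<theta>" "- \<kappa> \<theta> = a - b * \<theta>"
    using q'\<kappa>[OF \<theta>] q'\<kappa>[of "- \<theta>"] neg[OF \<theta>] by auto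
  \<comment> \<open>Adding the two equations gives \<open>a = 0\<close>.\<close>
  then have "\<kappa> \<theta> = b * \<theta>" by simp
  moreover have "\<kappa> \<theta> = 1 \<or> \<kappa> \<theta> = - 1" using K[OF \<theta>] \<open>K = 1\<close> by (simp add: power2_eq_1_iff)
  ultimately have "\<theta> = \<kappa> \<theta> / b" "\<kappa> \<theta> \<in> \<rat>" by auto
  then show "\<theta> \<in> \<rat>" using ab(2) by (metis Rats_divide)
qed

section \<open>Powers of two and conclusion\<close>

text \<open>Odd factors do not change the 2-adic valuation.\<close>

lemma odd_multiples_same_power_of_two:
  fixes k l a b :: int
  assumes "k * a = l * b" "odd a" "odd b" "l = 2 ^ n * m" "odd m"
  shows "\<exists>m'. odd m' \<and> k = 2 ^ n * m'"
proof -
  have "2 ^ n dvd k * a" using assms by simp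
  moreover have "coprime (2 ^ n) a" using \<open>odd a\<close> by simp
  ultimately have "2 ^ n dvd k" by (simp add: coprime_dvd_mult_left_iff)
  then obtain m' where m': "k = 2 ^ n * m'" by (auto elim: dvdE)
  then have "m' * a = m * b" using assms by simp
  then have "odd m'" using assms by (metis even_mult_iff)
  with m' show ?thesis by blast
qed

theorem theorem17:
  fixes adj :: "'v::finite \<Rightarrow> 'v \<Rightarrow> bool" and B C :: "'v set" and u v :: 'v and t :: real
  assumes "simple_graph adj"
    and "bipartition adj B C"
    and "perfect_state_transfer adj u v t"
    and "(u \<in> B \<and> v \<in> C) \<or> (u \<in> C \<and> v \<in> B)"
  shows "eigenvalue_support adj u \<subseteq> \<int> \<and>
    (\<exists>\<alpha>::nat. \<forall>\<theta> \<in> eigenvalue_support adj u. \<exists>m::int. odd m \<and> \<theta> = 2 ^ \<alpha> * of_int m) \<and>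
    0 \<notin> eigenvalue_support adj u"
proof (cases "eigenvalue_support adj u = {}")
  case False
  let ?A = "adj_matrix adj"
  define \<Phi> where "\<Phi> = eigenvalue_support adj u"
  have \<Phi>: "\<Phi> = {\<theta>. \<exists>y. ?A *v y = \<theta> *\<^sub>R y \<and> y $ u \<noteq> 0}"
    unfolding \<Phi>_def using mem_eigenvalue_support_iff[of _ adj u] by blast
  note sym = adj_matrix_symmetric[OF assms(1)]
  have int: "?A $ i $ j \<in> \<int>" for i j by (simp add: adj_matrix_def)
  obtain \<gamma> where \<gamma>: "\<And>\<theta> y. ?A *v y = \<theta> *\<^sub>R y \<Longrightarrow>
    exp (\<i> * of_real (t * \<theta>)) * of_real (y $ u) = \<gamma> * of_real (y $ v)"
    using perfect_state_transfer_eigenvector[OF assms(1,3)] by blast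
  define J where "J y = (\<chi> i. if i \<in> B then y $ i else - y $ i)" for y :: "real^'v"
  have J: "?A *v J y = (- \<theta>) *\<^sub>R J y" if "?A *v y = \<theta> *\<^sub>R y" for y \<theta>
    unfolding J_def using bipartite_eigenvector_negate[OF assms(2) that] .
  \<comment> \<open>Since \<open>u\<close> and \<open>v\<close> have different colours, exactly one
    of the two entries is negated.\<close>
  have Juv: "(J y $ u = y $ u \<and> J y $ v = - y $ v) \<or> (J y $ u = - y $ u \<and> J y $ v = y $ v)" for y
    using assms(2,4) by (auto simp: J_def bipartition_def)
  have \<gamma>0: "\<gamma> \<noteq> 0" using False \<gamma> by (fastforce simp: \<Phi>[unfolded \<Phi>_def])
  \<comment> \<open>On the support the quotient is already real, as \<open>\<kappa>\<gamma>\<close>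
    shows. For other eigenvalues the eigenvectors vanish at \<open>u\<close>, hence at
    \<open>v\<close>, and any value will do.\<close>
  define \<kappa> where "\<kappa> \<theta> = Re (exp (\<i> * of_real (t * \<theta>)) / \<gamma>)" for \<theta>
  have \<kappa>: "y $ v = \<kappa> \<theta> * y $ u" if y: "?A *v y = \<theta> *\<^sub>R y" for \<theta> y
  proof -
    have "complex_of_real (y $ v) = exp (\<i> * of_real (t * \<theta>)) / \<gamma> * of_real (y $ u)"
      using \<gamma>[OF y] \<gamma>0 by (simp add: field_simps)
    from arg_cong[OF this, of Re] show ?thesis
      by (simp only: \<kappa>_def times_complex.sel Re_complex_of_real Im_complex_of_real)
  qed
  have \<kappa>\<gamma>: "of_real (\<kappa> \<theta>) = exp (\<i> * of_real (t * \<theta>)) / \<gamma>" if \<theta>: "\<theta> \<in> \<Phi>" for \<theta>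
  proof -
    obtain y where y: "?A *v y = \<theta> *\<^sub>R y" "y $ u \<noteq> 0" using \<theta> by (auto simp: \<Phi>)
    have "exp (\<i> * of_real (t * \<theta>)) * of_real (y $ u) = \<gamma> * of_real (\<kappa> \<theta>) * of_real (y $ u)"
      using \<gamma>[OF y(1)] \<kappa>[OF y(1)] by simp
    then show ?thesis using y(2) \<gamma>0 by (simp add: field_simps)
  qed
  have neg: "- \<theta> \<in> \<Phi> \<and> \<kappa> (- \<theta>) = - \<kappa> \<theta>" if \<theta>: "\<theta> \<in> \<Phi>" for \<theta>
  proof -
    obtain y where y: "?A *v y = \<theta> *\<^sub>R y" "y $ u \<noteq> 0" using \<theta> by (auto simp: \<Phi>)
    have "J y $ u \<noteq> 0" using Juv[of y] y(2) by auto
    moreover have "\<kappa> (- \<theta>) = - \<kappa> \<theta>"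
      using \<kappa>[OF J[OF y(1)]] \<kappa>[OF y(1)] Juv[of y] y(2)
      by (metis mult_cancel_right mult_minus_left mult_minus_right minus_minus)
    ultimately show ?thesis using J[OF y(1)] by (auto simp: \<Phi>)
  qed
  have exp2: "exp (\<i> * of_real (t * \<theta>)) ^ 2 = - 1" if \<theta>: "\<theta> \<in> \<Phi>" for \<theta>
  proof -
    let ?z = "exp (\<i> * of_real (t * \<theta>))"
    have "exp (\<i> * of_real (t * (- \<theta>))) / \<gamma> = - (?z / \<gamma>)"
      using \<kappa>\<gamma>[of "- \<theta>"] \<kappa>\<gamma>[OF \<theta>] neg[OF \<theta>] by (metis of_real_minus)
    then have "inverse ?z = - ?z" using \<gamma>0 by (simp add: exp_minus field_simps)
    then have "?z * inverse ?z = - (?z ^ 2)" by (simp add: power2_eq_square)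
    then have "1 = - (?z ^ 2)" by simp
    then show ?thesis by (metis minus_minus)
  qed
  have odd: "\<exists>n::int. 2 * (t * \<theta>) = of_int (2 * n + 1) * pi" if \<theta>: "\<theta> \<in> \<Phi>" for \<theta>
  proof -
    have "cis (2 * (t * \<theta>)) = exp (\<i> * of_real (t * \<theta>)) ^ 2"
      by (simp add: cis_conv_exp mult_ac flip: exp_double)
    then have "cos (2 * (t * \<theta>)) = - 1"
      using arg_cong[OF exp2[OF \<theta>], of Re] by (metis cis.sel(1) one_complex.sel(1) uminus_complex.sel(1))
    then show ?thesis by (auto simp: cos_eq_minus1)
  qed
  have nz: "0 \<notin> \<Phi>"
    using odd[of 0] by (auto simp flip: of_int_add of_int_mult) presburger
  \<comment> \<open>The cross-multiplied form keeps the parities, which the final comparison of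
    powers of two requires.\<close>
  have ratio: "\<exists>a b::int. odd a \<and> odd b \<and> \<theta> * of_int a = \<phi> * of_int b"
    if tp: "\<theta> \<in> \<Phi>" "\<phi> \<in> \<Phi>" for \<theta> \<phi>
  proof -
    obtain n where n: "2 * (t * \<theta>) = of_int (2 * n + 1) * pi" using odd[OF tp(1)] by blast
    obtain m where m: "2 * (t * \<phi>) = of_int (2 * m + 1) * pi" using odd[OF tp(2)] by blast
    have "of_int (2 * n + 1) \<noteq> (0::real)" unfolding of_int_eq_0_iff by presburger
    then have "t \<noteq> 0" using n by auto
    have "pi * (2 * (t * \<theta>) * of_int (2 * m + 1)) = pi * (2 * (t * \<phi>) * of_int (2 * n + 1))"
      unfolding n m by simp
    then have "\<theta> * of_int (2 * m + 1) = \<phi> * of_int (2 * n + 1)"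
      using \<open>t \<noteq> 0\<close> by (simp add: mult.assoc)
    moreover have "odd (2 * m + 1)" "odd (2 * n + 1)" by simp_all
    ultimately show ?thesis by blast
  qed
  \<comment> \<open>The choice of \<open>K\<close> comes from squaring
    \<open>\<kappa>\<gamma>\<close> and applying \<open>exp2\<close>.\<close>
  have rat: "\<Phi> \<subseteq> \<rat>"
  proof (rule cospectral_symmetric_support_rational[OF sym int,
        where u = u and v = v and \<kappa> = \<kappa> and K = "Re (- 1 / \<gamma>\<^sup>2)", folded \<Phi>])
    show "\<theta> / \<phi> \<in> \<rat>" if tp: "\<theta> \<in> \<Phi>" "\<phi> \<in> \<Phi>" for \<theta> \<phi>
    proof -
      obtain a b :: int where ab: "odd a" "\<theta> * of_int a = \<phi> * of_int b"
        using ratio[OF tp] by blast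
      have "a \<noteq> 0" "\<phi> \<noteq> 0" using ab(1) tp(2) nz by auto
      then have "\<theta> / \<phi> = of_int b / of_int a" using ab(2) by (simp add: field_simps)
      then show ?thesis by simp
    qed
    show "(\<kappa> \<theta>)\<^sup>2 = Re (- 1 / \<gamma>\<^sup>2)" if "\<theta> \<in> \<Phi>" for \<theta>
    proof -
      have "complex_of_real ((\<kappa> \<theta>)\<^sup>2) = - 1 / \<gamma>\<^sup>2"
        using \<kappa>\<gamma>[OF that] exp2[OF that] by (simp add: power_divide)
      from arg_cong[OF this, of Re] show ?thesis by simp
    qed
  qed (use nz neg \<kappa> in auto)
  have ints: "\<theta> \<in> \<int>" if \<theta>: "\<theta> \<in> \<Phi>" for \<theta>
  proof -
    obtain r where r: "\<theta> = of_rat r" using rat \<theta> by (auto elim: Rats_cases)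
    obtain y where y: "?A *v y = \<theta> *\<^sub>R y" "y $ u \<noteq> 0" using \<theta> by (auto simp: \<Phi>)
    then have "r \<in> \<int>"
      by (intro rational_eigenvalue_integer_matrix[OF int, of y r]) (auto simp: r)
    then show ?thesis by (auto simp: r elim!: Ints_cases)
  qed
  \<comment> \<open>An arbitrary reference element fixes \<open>\<alpha>\<close> as its 2-adic
    valuation.\<close>
  obtain \<phi> where \<phi>: "\<phi> \<in> \<Phi>" using False by (auto simp: \<Phi>_def)
  obtain l where l: "\<phi> = of_int l" using ints[OF \<phi>] by (auto elim: Ints_cases)
  have "l \<noteq> 0" using l nz \<phi> by auto
  then obtain m where m: "l = 2 ^ multiplicity 2 l * m" "odd m"
    using multiplicity_decompose'[of l 2] by auto
  have "\<exists>m'. odd m' \<and> \<theta> = 2 ^ multiplicity 2 l * of_int m'" if \<theta>: "\<theta> \<in> \<Phi>" for \<theta>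
  proof -
    obtain k where k: "\<theta> = of_int k" using ints[OF \<theta>] by (auto elim: Ints_cases)
    obtain a b :: int where ab: "odd a" "odd b" "\<theta> * of_int a = \<phi> * of_int b"
      using ratio[OF \<theta> \<phi>] by blast
    have "k * a = l * b" using ab(3) unfolding k l by (metis of_int_eq_iff of_int_mult)
    from odd_multiples_same_power_of_two[OF this ab(1,2) m] obtain m'
      where "odd m'" "k = 2 ^ multiplicity 2 l * m'" by blast
    then show ?thesis by (auto simp: k)
  qed
  then show ?thesis using ints nz unfolding \<Phi>_def by blast
qed simp

end
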